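(* Let $(M,d)$ be a finite metric space with $|M|\ge2$. Then: (i) $CS(M)$ is a subgraph of both $\Sigma_M$ and $MC(M)$; (ii) if $M$ is intrinsic-I, then $\Sigma_M=CS(M)=MC(M)$; (iii) if $M$ is intrinsic-II and $\Sigma_M$ is a tree, then $\Sigma_M=CS(M)$. Moreover, there exist (intrinsic-II) finite metric spaces $M$ for which $\Sigma_M$, $CS(M)$ and $MC(M)$ are pairwise distinct.
   Context: All graphs are simple, undirected, with vertex set $M$. $K_{|M|}$ is the complete graph on $M$ with edge weights $d(x,y)$; path lengths are sums of weights, a geodesic from $x$ to $y$ is a path of minimal length, and the count of a path is its number of edges. $Q:=\{\{x,y\}:$ there is a geodesic from $x$ to $y$ in weighted $K_{|M|}$ with count $\ge2\}$ (equivalently, a path with at least two edges of total length $d(x,y)$), and $\Sigma_M$ is the graph with edge set $E(K_{|M|})\setminus Q$. $M$ is intrinsic if $\Sigma_M\ne K_{|M|}$; intrinsic-I if intrinsic and all edges $\{x,y\}$ of $\Sigma_M$ have the same length $d(x,y)=r$ for some constant $r>0$; intrinsic-II if intrinsic but not intrinsic-I. $MC(M)$: for $r\ge 0$ let $G_r$ have edges $\{x,y\}$, $x\ne y$, $d(x,y)\le r$; $MC(M)=G_r$ for the smallest $r\in\{d(x,y)\}$ with $G_r$ connected. $CS(M)$: $S_0$ has no edges, $K_0=\{\{x\}\}$; $\nu_0(\{x\})=\min_{y\ne x}d(x,y)$; $E(S_1)=\{\{x,y\}:y\ne x,\ d(x,y)=\nu_0(\{x\})\}$; if the set $K_i$ of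 components of $S_i$ has $|K_i|>1$, set $\nu_i(k)=\min\{d(x,y):x\in k,y\notin k\}$, $F(S_{i+1})=\{\{x,y\}:x\in k\in K_i,\ y\notin k,\ d(x,y)=\nu_i(k)\}$, $E(S_{i+1})=E(S_i)\cup F(S_{i+1})$; stop at the first connected $S_i$, which is $CS(M)$. *)

theory Defs
  imports "HOL-Analysis.Abstract_Metric_Spaces"
begin

text \<open>
  All graphs are simple and undirected on a common vertex set \<open>M\<close>, so a graph is given by its set
  of edges, each a two-element subset of \<open>M\<close>. Equality of graphs is equality of edge sets, and being
  a subgraph is inclusion of edge sets.
\<close>

definition complete_edges :: "'a set \<Rightarrow> 'a set set" where
  "complete_edges M = {{x, y} | x y. x \<in> M \<and> y \<in> M \<and> x \<noteq> y}"

text \<open>Paths are the nonempty lists of their pairwise distinct vertices; \<open>[x]\<close> is the path without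
  edges from \<open>x\<close> to \<open>x\<close>.\<close>

definition is_path :: "'a set \<Rightarrow> 'a set set \<Rightarrow> 'a \<Rightarrow> 'a list \<Rightarrow> 'a \<Rightarrow> bool" where
  "is_path M E x p y \<longleftrightarrow>
     p \<noteq> [] \<and> hd p = x \<and> last p = y \<and> set p \<subseteq> M \<and> distinct p \<and>
     successively (\<lambda>u v. {u, v} \<in> E) p"

definition path_count :: "'a list \<Rightarrow> nat" where
  "path_count p = length p - 1"

definition path_length :: "('a \<Rightarrow> 'a \<Rightarrow> real) \<Rightarrow> 'a list \<Rightarrow> real" where
  "path_length d p = (\<Sum>i<path_count p. d (p ! i) (p ! Suc i))"

definition connected_graph :: "'a set \<Rightarrow> 'a set set \<Rightarrow> bool" where
  "connected_graph M E \<longleftrightarrow> (\<forall>x\<in>M. \<forall>y\<in>M. \<exists>p. is_path M E x p y)"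

definition graph_components :: "'a set \<Rightarrow> 'a set set \<Rightarrow> 'a set set" where
  "graph_components M E = {{y \<in> M. \<exists>p. is_path M E x p y} | x. x \<in> M}"

definition is_cycle :: "'a set \<Rightarrow> 'a set set \<Rightarrow> 'a list \<Rightarrow> bool" where
  "is_cycle M E c \<longleftrightarrow>
     3 \<le> length c \<and> set c \<subseteq> M \<and> distinct c \<and>
     successively (\<lambda>u v. {u, v} \<in> E) c \<and> {last c, hd c} \<in> E"

definition is_tree :: "'a set \<Rightarrow> 'a set set \<Rightarrow> bool" where
  "is_tree M E \<longleftrightarrow> connected_graph M E \<and> (\<nexists>c. is_cycle M E c)"

definition geodesic :: "'a set \<Rightarrow> ('a \<Rightarrow> 'a \<Rightarrow> real) \<Rightarrow> 'a \<Rightarrow> 'a list \<Rightarrow> 'a \<Rightarrow> bool" where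
  "geodesic M d x p y \<longleftrightarrow>
     is_path M (complete_edges M) x p y \<and>
     (\<forall>q. is_path M (complete_edges M) x q y \<longrightarrow> path_length d p \<le> path_length d q)"

definition Q_edges :: "'a set \<Rightarrow> ('a \<Rightarrow> 'a \<Rightarrow> real) \<Rightarrow> 'a set set" where
  "Q_edges M d = {{x, y} | x y. x \<in> M \<and> y \<in> M \<and> (\<exists>p. geodesic M d x p y \<and> 2 \<le> path_count p)}"

definition Sigma_graph :: "'a set \<Rightarrow> ('a \<Rightarrow> 'a \<Rightarrow> real) \<Rightarrow> 'a set set" where
  "Sigma_graph M d = complete_edges M - Q_edges M d"

definition intrinsic :: "'a set \<Rightarrow> ('a \<Rightarrow> 'a \<Rightarrow> real) \<Rightarrow> bool" where
  "intrinsic M d \<longleftrightarrow> Sigma_graph M d \<noteq> complete_edges M"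

definition intrinsic_I :: "'a set \<Rightarrow> ('a \<Rightarrow> 'a \<Rightarrow> real) \<Rightarrow> bool" where
  "intrinsic_I M d \<longleftrightarrow>
     intrinsic M d \<and> (\<exists>r>0. \<forall>x y. {x, y} \<in> Sigma_graph M d \<longrightarrow> d x y = r)"

definition intrinsic_II :: "'a set \<Rightarrow> ('a \<Rightarrow> 'a \<Rightarrow> real) \<Rightarrow> bool" where
  "intrinsic_II M d \<longleftrightarrow> intrinsic M d \<and> \<not> intrinsic_I M d"

definition threshold_graph :: "'a set \<Rightarrow> ('a \<Rightarrow> 'a \<Rightarrow> real) \<Rightarrow> real \<Rightarrow> 'a set set" where
  "threshold_graph M d r = {{x, y} | x y. x \<in> M \<and> y \<in> M \<and> x \<noteq> y \<and> d x y \<le> r}"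

definition MC_graph :: "'a set \<Rightarrow> ('a \<Rightarrow> 'a \<Rightarrow> real) \<Rightarrow> 'a set set" where
  "MC_graph M d =
     threshold_graph M d
       (Min {r. (\<exists>x\<in>M. \<exists>y\<in>M. r = d x y) \<and> connected_graph M (threshold_graph M d r)})"

definition CS_nu :: "'a set \<Rightarrow> ('a \<Rightarrow> 'a \<Rightarrow> real) \<Rightarrow> 'a set \<Rightarrow> real" where
  "CS_nu M d k = Min {d x y | x y. x \<in> k \<and> y \<in> M - k}"

text \<open>
  The components of the edgeless graph \<open>S\<^sub>0\<close> are the singletons, so the first step of the
  construction is the instance \<open>i = 0\<close> of the general one. Once \<open>S\<^sub>i\<close> is connected, its only
  component is \<open>M\<close>, no edge is added and \<open>CS_nu\<close> (then a minimum over the empty set) is irrelevant.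
\<close>

primrec CS_step :: "'a set \<Rightarrow> ('a \<Rightarrow> 'a \<Rightarrow> real) \<Rightarrow> nat \<Rightarrow> 'a set set" where
  "CS_step M d 0 = {}"
| "CS_step M d (Suc i) =
     CS_step M d i \<union>
     {{x, y} | x y k. k \<in> graph_components M (CS_step M d i) \<and>
                      x \<in> k \<and> y \<in> M - k \<and> d x y = CS_nu M d k}"

definition CS_graph :: "'a set \<Rightarrow> ('a \<Rightarrow> 'a \<Rightarrow> real) \<Rightarrow> 'a set set" where
  "CS_graph M d = CS_step M d (LEAST i. connected_graph M (CS_step M d i))"

end

(* An edge {x, y} of CS(M) realises the distance between a set k and its complement, where x lies
   in k and y does not. A further point z lies on one of the two sides, so one of d(x,z), d(z,y)
   is at least d(x,y). In particular z is not between x and y, whence CS(M) is contained in the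
   graph Sigma. Every edge of CS(M) is at most the connectivity threshold r because G_r joins k to
   its complement, which gives the inclusion in MC(M). As CS(M) is connected, it equals Sigma if
   Sigma is a tree. If all edges of Sigma have the same length r, then r is the nearest-neighbour
   distance of every point, and all three graphs consist of the pairs at distance r.

   The four points 0, 1, 2, 3 with d01 = 2, d12 = 3, d02 = 4, d23 = 5, d03 = 7, d13 = 8 separate
   the three graphs: {0,3} is in Sigma but not in MC, and {0,2} is in MC but not in CS. *)

theory Submission
  imports Defs
begin

subsection \<open>Paths and connectivity\<close>

text \<open>Reachability is handled through the closure of this relation, which composes and
  reverses more easily than lists of distinct vertices. Membership in \<open>M\<close> is built in
  because \<open>E\<close> is arbitrary while paths stay inside \<open>M\<close>.\<close>

definition adjacent :: "'a set \<Rightarrow> 'a set set \<Rightarrow> 'a \<Rightarrow> 'a \<Rightarrow> bool" where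
  "adjacent M E u v \<longleftrightarrow> u \<in> M \<and> v \<in> M \<and> {u, v} \<in> E"

lemma is_path_Cons_Cons:
  "is_path M E x (u # v # p) y \<longleftrightarrow>
     u = x \<and> u \<in> M \<and> u \<notin> set (v # p) \<and> {u, v} \<in> E \<and> is_path M E v (v # p) y"
  by (auto simp: is_path_def)

lemma is_path_imp_rtranclp:
  assumes "is_path M E x p y"
  shows "(adjacent M E)\<^sup>*\<^sup>* x y"
  using assms
proof (induction p arbitrary: x)
  case Nil
  then show ?case by (simp add: is_path_def)
next
  case (Cons u p)
  show ?case
  proof (cases p)
    case Nil
    then show ?thesis using Cons.prems by (auto simp: is_path_def)
  next
    case (Cons v q)
    then have *: "u = x" "u \<in> M" "{u, v} \<in> E" and path: "is_path M E v p y"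
      using Cons.prems by (auto simp: is_path_Cons_Cons)
    then have "adjacent M E x v"
      using \<open>p = v # q\<close> by (auto simp: adjacent_def is_path_def)
    then show ?thesis using Cons.IH[OF path] by (rule converse_rtranclp_into_rtranclp)
  qed
qed

lemma rtranclp_imp_is_path:
  assumes "(adjacent M E)\<^sup>*\<^sup>* x y" "y \<in> M"
  shows "\<exists>p. is_path M E x p y"
  using assms
proof (induction rule: converse_rtranclp_induct)
  case base
  then have "is_path M E y [y] y" by (simp add: is_path_def)
  then show ?case by blast
next
  case (step u v)
  then obtain p where p: "is_path M E v p y" by blast
  show ?case
  proof (cases "u \<in> set p")
    case True
    \<comment> \<open>Prepending \<open>u\<close> would repeat a vertex, so the path is cut short:
      its part from \<open>u\<close> onwards already joins \<open>u\<close> to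
      \<open>y\<close>.\<close>
    then obtain q r where "p = q @ u # r" by (meson split_list)
    then have "is_path M E u (u # r) y"
      using p by (auto simp: is_path_def successively_append_iff)
    then show ?thesis by blast
  next
    case False
    then have "is_path M E u (u # p) y"
      using p step.hyps by (cases p) (auto simp: is_path_def adjacent_def)
    then show ?thesis by blast
  qed
qed

lemma ex_is_path_iff:
  assumes "y \<in> M"
  shows "(\<exists>p. is_path M E x p y) \<longleftrightarrow> (adjacent M E)\<^sup>*\<^sup>* x y"
  using assms is_path_imp_rtranclp rtranclp_imp_is_path by metis

lemma symp_rtranclp_adjacent: "symp ((adjacent M E)\<^sup>*\<^sup>*)"
  by (intro symp_rtranclp) (auto simp: symp_def adjacent_def insert_commute)

lemma connected_graphI:
  assumes "\<And>x. x \<in> M \<Longrightarrow> (adjacent M E)\<^sup>*\<^sup>* x c"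
  shows "connected_graph M E"
  unfolding connected_graph_def
proof (intro ballI)
  fix x y assume "x \<in> M" "y \<in> M"
  then have "(adjacent M E)\<^sup>*\<^sup>* x y"
    using assms symp_rtranclp_adjacent[THEN sympD] rtranclp_trans by metis
  then show "\<exists>p. is_path M E x p y" using \<open>y \<in> M\<close> by (rule rtranclp_imp_is_path)
qed

lemma connected_graph_mono:
  assumes "connected_graph M E" "E \<subseteq> F"
  shows "connected_graph M F"
  using assms successively_mono unfolding connected_graph_def is_path_def
  by (metis (no_types, lifting) subsetD)

lemma rtranclp_closed:
  assumes "(adjacent M E)\<^sup>*\<^sup>* x y" "x \<in> k"
    and "\<And>u v. u \<in> k \<Longrightarrow> v \<in> M - k \<Longrightarrow> {u, v} \<notin> E"
  shows "y \<in> k"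
  using assms(1,2) by induction (use assms(3) in \<open>auto simp: adjacent_def\<close>)

text \<open>Otherwise \<open>k\<close> would be closed under adjacency, and no path from
  \<open>x\<close> could reach \<open>y\<close>.\<close>

lemma connected_graph_crossing:
  assumes "connected_graph M E" "k \<subseteq> M" "x \<in> k" "y \<in> M - k"
  obtains u v where "u \<in> k" "v \<in> M - k" "{u, v} \<in> E"
proof -
  have "(adjacent M E)\<^sup>*\<^sup>* x y"
    using assms is_path_imp_rtranclp unfolding connected_graph_def by fast
  then show thesis using that rtranclp_closed[of M E x y k] assms by blast
qed

lemma graph_components_subset: "k \<in> graph_components M E \<Longrightarrow> k \<subseteq> M"
  by (auto simp: graph_components_def)

lemma graph_components_closed:
  assumes "k \<in> graph_components M E" "u \<in> k" "{u, v} \<in> E" "v \<in> M"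
  shows "v \<in> k"
proof -
  obtain x where k: "k = {y \<in> M. \<exists>p. is_path M E x p y}"
    using assms(1) by (auto simp: graph_components_def)
  then have "(adjacent M E)\<^sup>*\<^sup>* x u" "u \<in> M"
    using assms(2) is_path_imp_rtranclp by fast+
  then have "(adjacent M E)\<^sup>*\<^sup>* x v"
    using assms(3,4) by (meson adjacent_def rtranclp.rtrancl_into_rtrancl)
  then show ?thesis using k assms(4) rtranclp_imp_is_path by fast
qed

lemma not_connected_graph_component:
  assumes "\<not> connected_graph M E"
  obtains k x y where "k \<in> graph_components M E" "x \<in> k" "y \<in> M - k"
proof -
  obtain x y where xy: "x \<in> M" "y \<in> M" "\<nexists>p. is_path M E x p y"
    using assms by (auto simp: connected_graph_def)
  let ?k = "{y \<in> M. \<exists>p. is_path M E x p y}"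
  have "?k \<in> graph_components M E" using xy by (auto simp: graph_components_def)
  moreover have "x \<in> ?k" using xy(1) rtranclp_imp_is_path by fast
  moreover have "y \<in> M - ?k" using xy by blast
  ultimately show thesis by (rule that)
qed

text \<open>A path in \<open>F\<close> between the ends of an edge of \<open>E\<close> missing from
  \<open>F\<close> would close up with that edge to a cycle in \<open>E\<close>.\<close>

lemma tree_eq_connected_subgraph:
  assumes "is_tree M E" "connected_graph M F" "F \<subseteq> E" "E \<subseteq> complete_edges M"
  shows "F = E"
proof (rule ccontr)
  assume "F \<noteq> E"
  then obtain x y where xy: "{x, y} \<in> E" "{x, y} \<notin> F" "x \<in> M" "y \<in> M" "x \<noteq> y"
    using assms(3,4) unfolding complete_edges_def by blast
  then obtain p where p: "is_path M F x p y"
    using assms(2) unfolding connected_graph_def by blast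
  \<comment> \<open>One vertex is excluded by \<open>x \<noteq> y\<close>, two by
    \<open>{x, y} \<notin> F\<close>.\<close>
  then have "3 \<le> length p"
    using xy by (cases p; cases "tl p"; cases "tl (tl p)") (auto simp: is_path_def)
  moreover have "successively (\<lambda>u v. {u, v} \<in> E) p"
    using p assms(3) unfolding is_path_def by (auto elim: successively_mono)
  ultimately have "is_cycle M E p"
    using p xy by (auto simp: is_cycle_def is_path_def insert_commute)
  then show False using assms(1) by (auto simp: is_tree_def)
qed

lemma path_length_Cons_Cons: "path_length d (u # v # p) = d u v + path_length d (v # p)"
  unfolding path_length_def path_count_def
  by (simp add: sum.lessThan_Suc_shift del: sum.lessThan_Suc)

context Metric_space
begin

subsection \<open>The graph \<open>\<Sigma>\<close>\<close>

text \<open>This is the iterated triangle inequality. The edge set is arbitrary because only the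
  vertices matter.\<close>

lemma path_length_ge:
  assumes "is_path M E x p y"
  shows "d x y \<le> path_length d p"
  using assms
proof (induction p arbitrary: x)
  case Nil
  then show ?case by (simp add: is_path_def)
next
  case (Cons u p)
  show ?case
  proof (cases p)
    case Nil
    then show ?thesis
      using Cons.prems by (auto simp: is_path_def path_length_def path_count_def)
  next
    case (Cons v q)
    then have "u = x" "x \<in> M" and path: "is_path M E v p y"
      using Cons.prems by (auto simp: is_path_Cons_Cons)
    moreover have "v \<in> M" "y \<in> M"
      using path last_in_set[of p] \<open>p = v # q\<close> by (auto simp: is_path_def)
    ultimately have "d x y \<le> d x v + path_length d p"
      using Cons.IH[OF path] triangle[of x v y] by linarith
    then show ?thesis using Cons \<open>u = x\<close> by (simp add: path_length_Cons_Cons)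
  qed
qed

text \<open>The single edge is itself a path, so every geodesic has length \<open>d x y\<close>. The
  triangle inequality is then an equality at the second vertex; conversely, a point in between gives
  a geodesic with two edges.\<close>

lemma geodesic_count_ge_2_iff:
  assumes "x \<in> M" "y \<in> M" "x \<noteq> y"
  shows "(\<exists>p. geodesic M d x p y \<and> 2 \<le> path_count p) \<longleftrightarrow>
         (\<exists>z\<in>M - {x, y}. d x z + d z y = d x y)"
proof
  assume "\<exists>p. geodesic M d x p y \<and> 2 \<le> path_count p"
  then obtain p where geo: "geodesic M d x p y" and "2 \<le> path_count p" by blast
  then obtain u z w q where p: "p = u # z # w # q"
    by (cases p; cases "tl p"; cases "tl (tl p)") (auto simp: path_count_def)
  have path: "is_path M (complete_edges M) x p y" using geo by (simp add: geodesic_def)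
  then have tail: "is_path M (complete_edges M) z (z # w # q) y" and [simp]: "u = x"
    by (simp_all add: p is_path_Cons_Cons)
  \<comment> \<open>The end \<open>y\<close> is the last entry of \<open>w # q\<close>, so
    distinctness separates \<open>z\<close> from both ends.\<close>
  have "z \<in> M" "z \<noteq> x" "z \<noteq> y"
    using path by (auto simp: p is_path_def split: if_splits)
  have "is_path M (complete_edges M) x [x, y] y"
    using assms by (auto simp: is_path_def complete_edges_def)
  then have "path_length d p \<le> path_length d [x, y]"
    using geo by (simp add: geodesic_def)
  moreover have "path_length d [x, y] = d x y"
    by (simp add: path_length_def path_count_def)
  moreover have "d x z + d z y \<le> path_length d p"
    using path_length_ge[OF tail] by (simp add: p path_length_Cons_Cons)
  ultimately have "d x z + d z y = d x y"
    using triangle[of x z y] assms \<open>z \<in> M\<close> by linarith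
  then show "\<exists>z\<in>M - {x, y}. d x z + d z y = d x y"
    using \<open>z \<in> M\<close> \<open>z \<noteq> x\<close> \<open>z \<noteq> y\<close> by blast
next
  assume "\<exists>z\<in>M - {x, y}. d x z + d z y = d x y"
  then obtain z where z: "z \<in> M" "z \<noteq> x" "z \<noteq> y" "d x z + d z y = d x y" by blast
  have "is_path M (complete_edges M) x [x, z, y] y"
    using assms z by (auto simp: is_path_def complete_edges_def)
  moreover have "path_length d [x, z, y] = d x y"
    using z by (simp add: path_length_def path_count_def)
  ultimately have "geodesic M d x [x, z, y] y"
    using path_length_ge by (simp add: geodesic_def)
  moreover have "2 \<le> path_count [x, z, y]" by (simp add: path_count_def)
  ultimately show "\<exists>p. geodesic M d x p y \<and> 2 \<le> path_count p" by blast
qed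

lemma Q_edges_iff:
  assumes "x \<in> M" "y \<in> M" "x \<noteq> y"
  shows "{x, y} \<in> Q_edges M d \<longleftrightarrow> (\<exists>z\<in>M - {x, y}. d x z + d z y = d x y)"
proof -
  \<comment> \<open>An unordered pair can be witnessed in either orientation; symmetry of
    \<open>d\<close> merges the two cases.\<close>
  have "{x, y} \<in> Q_edges M d \<longleftrightarrow>
      (\<exists>p. geodesic M d x p y \<and> 2 \<le> path_count p) \<or>
      (\<exists>p. geodesic M d y p x \<and> 2 \<le> path_count p)"
    using assms by (auto simp: Q_edges_def doubleton_eq_iff)
  also have "\<dots> \<longleftrightarrow> (\<exists>z\<in>M - {x, y}. d x z + d z y = d x y)"
    using assms geodesic_count_ge_2_iff[of x y] geodesic_count_ge_2_iff[of y x]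
    by (simp add: insert_commute commute add.commute)
  finally show ?thesis .
qed

lemma Sigma_graph_iff:
  assumes "x \<in> M" "y \<in> M" "x \<noteq> y"
  shows "{x, y} \<in> Sigma_graph M d \<longleftrightarrow> (\<forall>z\<in>M - {x, y}. d x z + d z y \<noteq> d x y)"
  using assms Q_edges_iff[OF assms] by (auto simp: Sigma_graph_def complete_edges_def)

lemma Sigma_graph_subset: "Sigma_graph M d \<subseteq> complete_edges M"
  by (auto simp: Sigma_graph_def)

end

locale finite_Metric_space = Metric_space +
  assumes finite_M: "finite M"
begin

subsection \<open>The graph \<open>CS\<close>\<close>

lemma finite_crossing_distances:
  assumes "k \<subseteq> M"
  shows "finite {d x y | x y. x \<in> k \<and> y \<in> M - k}"
proof (rule finite_subset)
  show "{d x y | x y. x \<in> k \<and> y \<in> M - k} \<subseteq> (\<lambda>(x, y). d x y) ` (M \<times> M)"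
    using assms by force
qed (simp add: finite_M)

lemma CS_nu_le:
  assumes "k \<subseteq> M" "x \<in> k" "y \<in> M - k"
  shows "CS_nu M d k \<le> d x y"
  unfolding CS_nu_def using assms by (intro Min_le finite_crossing_distances) auto

lemma CS_nu_attained:
  assumes "k \<subseteq> M" "x \<in> k" "y \<in> M - k"
  obtains u v where "u \<in> k" "v \<in> M - k" "d u v = CS_nu M d k"
proof -
  have "CS_nu M d k \<in> {d x y | x y. x \<in> k \<and> y \<in> M - k}"
    unfolding CS_nu_def using assms by (intro Min_in finite_crossing_distances) auto
  then show thesis using that by auto
qed

text \<open>This extracts from the recursion what the comparisons with the other graphs use: an edge
  is shortest across some cut. The set \<open>k\<close> is a component of the stage at which the
  edge was added, not necessarily of the latest one.\<close>

lemma CS_step_edgeE: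
  assumes "e \<in> CS_step M d i"
  obtains x y k where "e = {x, y}" "k \<subseteq> M" "x \<in> k" "y \<in> M - k"
    "\<And>u v. u \<in> k \<Longrightarrow> v \<in> M - k \<Longrightarrow> d x y \<le> d u v"
  using assms
proof (induction i arbitrary: thesis)
  case 0
  then show ?case by simp
next
  case (Suc i)
  show ?case
  proof (cases "e \<in> CS_step M d i")
    case True
    then show ?thesis using Suc.IH Suc.prems(1) by blast
  next
    case False
    then obtain x y k where "e = {x, y}" "k \<in> graph_components M (CS_step M d i)"
        "x \<in> k" "y \<in> M - k" "d x y = CS_nu M d k"
      using Suc.prems(2) by auto
    then show ?thesis
      using Suc.prems(1)[of x y k] graph_components_subset CS_nu_le by metis
  qed
qed

lemma CS_step_subset: "CS_step M d i \<subseteq> complete_edges M"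
  by (fastforce elim: CS_step_edgeE simp: complete_edges_def)

lemma CS_step_mono: "i \<le> j \<Longrightarrow> CS_step M d i \<subseteq> CS_step M d j"
  by (rule lift_Suc_mono_le) auto

lemma finite_complete_edges: "finite (complete_edges M)"
  by (rule finite_subset[of _ "Pow M"]) (auto simp: complete_edges_def finite_M)

text \<open>A shortest edge leaving a component is added, and it is new because no earlier edge
  leaves a component.\<close>

lemma CS_step_Suc_psubset:
  assumes "\<not> connected_graph M (CS_step M d i)"
  shows "CS_step M d i \<subset> CS_step M d (Suc i)"
proof -
  obtain k x y where k: "k \<in> graph_components M (CS_step M d i)" "x \<in> k" "y \<in> M - k"
    using assms by (rule not_connected_graph_component)
  then obtain u v where uv: "u \<in> k" "v \<in> M - k" "d u v = CS_nu M d k"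
    using CS_nu_attained graph_components_subset by metis
  then have "{u, v} \<in> CS_step M d (Suc i)" using k by auto
  moreover have "{u, v} \<notin> CS_step M d i"
    using graph_components_closed[OF k(1) uv(1)] uv(2) by blast
  moreover have "CS_step M d i \<subseteq> CS_step M d (Suc i)" by (rule CS_step_mono) simp
  ultimately show ?thesis by blast
qed

text \<open>The \<open>LEAST\<close> in \<open>CS_graph\<close> is thereby meaningful. Without a
  connected stage the edge sets would grow strictly forever inside a finite set.\<close>

lemma ex_connected_CS_step: "\<exists>i. connected_graph M (CS_step M d i)"
proof (rule ccontr)
  assume *: "\<nexists>i. connected_graph M (CS_step M d i)"
  have fin: "finite (CS_step M d i)" for i
    using CS_step_subset finite_complete_edges by (rule finite_subset)
  have "i \<le> card (CS_step M d i)" for i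
  proof (induction i)
    case (Suc i)
    have "card (CS_step M d i) < card (CS_step M d (Suc i))"
      using * CS_step_Suc_psubset fin by (blast intro: psubset_card_mono)
    then show ?case using Suc by simp
  qed simp
  moreover have "card (CS_step M d i) \<le> card (complete_edges M)" for i
    using CS_step_subset finite_complete_edges by (simp add: card_mono)
  ultimately show False using Suc_n_not_le_n le_trans by blast
qed

lemma connected_CS_graph: "connected_graph M (CS_graph M d)"
  unfolding CS_graph_def using ex_connected_CS_step by (rule LeastI_ex)

lemma CS_graph_edgeE:
  assumes "e \<in> CS_graph M d"
  obtains x y k where "e = {x, y}" "k \<subseteq> M" "x \<in> k" "y \<in> M - k"
    "\<And>u v. u \<in> k \<Longrightarrow> v \<in> M - k \<Longrightarrow> d x y \<le> d u v"
  using assms unfolding CS_graph_def by (rule CS_step_edgeE) blast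

lemma CS_graph_ultrametric:
  assumes "{x, y} \<in> CS_graph M d" "z \<in> M"
  shows "d x y \<le> max (d x z) (d z y)"
proof -
  obtain a b k where k: "{x, y} = {a, b}" "a \<in> k" "b \<in> M - k"
      "\<And>u v. u \<in> k \<Longrightarrow> v \<in> M - k \<Longrightarrow> d a b \<le> d u v"
    using assms(1) by (rule CS_graph_edgeE) blast
  have "d a b \<le> max (d a z) (d z b)"
    \<comment> \<open>If \<open>z\<close> lies in \<open>k\<close>, the pair \<open>z\<close>,
      \<open>b\<close> crosses the cut; otherwise the pair \<open>a\<close>, \<open>z\<close>
      does.\<close>
    using k(4)[of a z] k(4)[of z b] k(2,3) assms(2) by (cases "z \<in> k") auto
  then show ?thesis using k(1) by (auto simp: doubleton_eq_iff commute max.commute)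
qed

lemma CS_graph_subset_Sigma_graph: "CS_graph M d \<subseteq> Sigma_graph M d"
proof
  fix e assume e: "e \<in> CS_graph M d"
  then obtain x y k where "e = {x, y}" "k \<subseteq> M" "x \<in> k" "y \<in> M - k"
    by (rule CS_graph_edgeE)
  then have xy: "x \<in> M" "y \<in> M" "x \<noteq> y" "e = {x, y}" by auto
  have "d x z + d z y \<noteq> d x y" if "z \<in> M - {x, y}" for z
  proof -
    have "d x y \<le> max (d x z) (d z y)" using CS_graph_ultrametric e xy that by simp
    \<comment> \<open>Both summands are positive, so their sum exceeds their maximum.\<close>
    moreover have "0 < d x z" "0 < d z y" using xy that by auto
    ultimately show ?thesis by linarith
  qed
  then show "e \<in> Sigma_graph M d" using xy Sigma_graph_iff by simp
qed

lemma connected_Sigma_graph: "connected_graph M (Sigma_graph M d)"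
  using connected_CS_graph CS_graph_subset_Sigma_graph by (rule connected_graph_mono)

text \<open>Such pairs enter at the first step, where the components are singletons and
  \<open>CS_nu\<close> is the nearest-neighbour distance.\<close>

lemma nearest_neighbour_in_CS_graph:
  assumes "x \<in> M" "y \<in> M" "x \<noteq> y" "\<And>z. z \<in> M - {x} \<Longrightarrow> d x y \<le> d x z"
  shows "{x, y} \<in> CS_graph M d"
proof -
  have not_adj: "\<not> adjacent M {} u v" for u v :: 'a by (simp add: adjacent_def)
  then have rtranclp_iff: "(adjacent M {})\<^sup>*\<^sup>* u v \<longleftrightarrow> u = v" for u v :: 'a
    by (metis converse_rtranclpE rtranclp.rtrancl_refl)
  \<comment> \<open>Two distinct points without edges are not connected, so the construction runs
    for at least one step and stage 1 lies inside \<open>CS_graph M d\<close>.\<close>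
  have not_conn: "\<not> connected_graph M (CS_step M d 0)"
    using assms(1-3) ex_is_path_iff[of y M "{}" x]
    by (auto simp: connected_graph_def rtranclp_iff)
  have "{z \<in> M. \<exists>p. is_path M {} x p z} = {x}"
    using assms(1) by (auto simp: ex_is_path_iff rtranclp_iff cong: conj_cong)
  then have "{x} \<in> graph_components M {}"
    using assms(1) unfolding graph_components_def by blast
  moreover obtain u v where uv: "u \<in> {x}" "v \<in> M - {x}" "d u v = CS_nu M d {x}"
    by (rule CS_nu_attained[of "{x}" x y]) (use assms in auto)
  then have "d x y = CS_nu M d {x}"
    using assms(1-3) assms(4)[OF uv(2)] CS_nu_le[of "{x}" x y] by auto
  ultimately have "{x, y} \<in> CS_step M d (Suc 0)"
    using assms by auto
  moreover have "Suc 0 \<le> (LEAST i. connected_graph M (CS_step M d i))"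
    using not_conn LeastI_ex[OF ex_connected_CS_step] by (metis Suc_leI gr0I)
  ultimately show ?thesis unfolding CS_graph_def using CS_step_mono by blast
qed

subsection \<open>The graph \<open>MC\<close>\<close>

text \<open>These are the candidates for the threshold of \<open>MC_graph\<close>. The points
  \<open>x\<close> and \<open>y\<close> may coincide, but the value 0 connects only a one-point
  space.\<close>

definition connecting_distances :: "real set" where
  "connecting_distances =
     {r. (\<exists>x\<in>M. \<exists>y\<in>M. r = d x y) \<and> connected_graph M (threshold_graph M d r)}"

lemma MC_graph_eq: "MC_graph M d = threshold_graph M d (Min connecting_distances)"
  by (simp add: MC_graph_def connecting_distances_def)

lemma finite_connecting_distances: "finite connecting_distances"
proof (rule finite_subset)
  show "connecting_distances \<subseteq> (\<lambda>(x, y). d x y) ` (M \<times> M)"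
    by (force simp: connecting_distances_def)
qed (simp add: finite_M)

lemma connecting_distances_nonempty:
  assumes "M \<noteq> {}"
  shows "connecting_distances \<noteq> {}"
proof -
  let ?D = "(\<lambda>(x, y). d x y) ` (M \<times> M)"
  have fin: "finite ?D" and "?D \<noteq> {}" using assms by (auto simp: finite_M)
  then have "Max ?D \<in> ?D" by (rule Max_in)
  then have ex: "\<exists>x\<in>M. \<exists>y\<in>M. Max ?D = d x y" by auto
  have "d x y \<le> Max ?D" if "x \<in> M" "y \<in> M" for x y
    using fin by (rule Max_ge) (use that in auto)
  then have "complete_edges M \<subseteq> threshold_graph M d (Max ?D)"
    by (fastforce simp: complete_edges_def threshold_graph_def)
  \<comment> \<open>The threshold graph at the largest distance is connected because it contains the
    connected graph \<open>Sigma_graph M d\<close>.\<close>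
  then have "Sigma_graph M d \<subseteq> threshold_graph M d (Max ?D)"
    using Sigma_graph_subset by blast
  then have "Max ?D \<in> connecting_distances"
    using ex connected_graph_mono[OF connected_Sigma_graph]
    by (simp add: connecting_distances_def)
  then show ?thesis by blast
qed

lemma connected_MC_graph:
  assumes "M \<noteq> {}"
  shows "connected_graph M (MC_graph M d)"
  using Min_in[OF finite_connecting_distances connecting_distances_nonempty[OF assms]]
  by (simp add: MC_graph_eq connecting_distances_def)

text \<open>Any distance known to connect \<open>M\<close> bounds the threshold from above, so the
  minimum need not be computed.\<close>

lemma MC_graph_subset_threshold_graph:
  assumes "x \<in> M" "y \<in> M" "connected_graph M (threshold_graph M d (d x y))"
  shows "MC_graph M d \<subseteq> threshold_graph M d (d x y)"
proof -
  have "Min connecting_distances \<le> d x y"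
    using finite_connecting_distances
    by (rule Min_le) (use assms in \<open>auto simp: connecting_distances_def\<close>)
  then show ?thesis unfolding MC_graph_eq threshold_graph_def by force
qed

text \<open>A known edge bounds the threshold from below by its length.\<close>

lemma MC_graph_downward_closed:
  assumes "{u, v} \<in> MC_graph M d" "d x y \<le> d u v" "x \<in> M" "y \<in> M" "x \<noteq> y"
  shows "{x, y} \<in> MC_graph M d"
proof -
  have "d u v \<le> Min connecting_distances"
    using assms(1) by (auto simp: MC_graph_eq threshold_graph_def doubleton_eq_iff commute)
  then have "d x y \<le> Min connecting_distances" using assms(2) by simp
  then show ?thesis using assms(3-5) unfolding MC_graph_eq threshold_graph_def by blast
qed

lemma CS_graph_subset_MC_graph: "CS_graph M d \<subseteq> MC_graph M d"
proof
  fix e assume "e \<in> CS_graph M d"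
  then obtain x y k where k: "e = {x, y}" "k \<subseteq> M" "x \<in> k" "y \<in> M - k"
      "\<And>u v. u \<in> k \<Longrightarrow> v \<in> M - k \<Longrightarrow> d x y \<le> d u v"
    by (rule CS_graph_edgeE) blast
  have "M \<noteq> {}" using k by auto
  \<comment> \<open>Connectedness forces an edge of \<open>MC_graph M d\<close> across the cut
    \<open>k\<close>, and \<open>{x, y}\<close> is no longer than that edge.\<close>
  obtain u v where uv: "u \<in> k" "v \<in> M - k" "{u, v} \<in> MC_graph M d"
    using connected_MC_graph[OF \<open>M \<noteq> {}\<close>] k(2-4) by (rule connected_graph_crossing)
  from uv(3) k(5)[OF uv(1,2)] show "e \<in> MC_graph M d"
    unfolding k(1) by (rule MC_graph_downward_closed) (use k(2-4) in auto)
qed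

subsection \<open>Equality of the three graphs for constant edge length\<close>

text \<open>A nearest neighbour of \<open>x\<close> gives an edge of \<open>CS_graph M d\<close>,
  hence of \<open>Sigma_graph M d\<close>; its length is therefore \<open>r\<close>.\<close>

lemma Sigma_edge_shortest:
  assumes const: "\<And>x y. {x, y} \<in> Sigma_graph M d \<Longrightarrow> d x y = r"
    and "x \<in> M" "y \<in> M" "x \<noteq> y"
  shows "r \<le> d x y"
proof -
  let ?D = "d x ` (M - {x})"
  have fin: "finite ?D" "?D \<noteq> {}" using finite_M assms by auto
  then have "Min ?D \<in> ?D" by (rule Min_in)
  then obtain z where z: "z \<in> M - {x}" "d x z = Min ?D" by (metis imageE)
  have min: "Min ?D \<le> d x w" if "w \<in> M - {x}" for w
    using fin(1) that by simp
  then have "{x, z} \<in> CS_graph M d"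
    using z(1) min[folded z(2)] \<open>x \<in> M\<close> by (intro nearest_neighbour_in_CS_graph) auto
  then have "d x z = r" by (intro const subsetD[OF CS_graph_subset_Sigma_graph])
  then show ?thesis using min[of y] z(2) \<open>y \<in> M\<close> \<open>x \<noteq> y\<close> by simp
qed

text \<open>The length \<open>r\<close> is the least distance between distinct points, so the ends
  of an edge of \<open>Sigma_graph M d\<close> are nearest neighbours.\<close>

lemma CS_graph_eq_Sigma_graph:
  assumes const: "\<And>x y. {x, y} \<in> Sigma_graph M d \<Longrightarrow> d x y = r"
  shows "CS_graph M d = Sigma_graph M d"
proof
  show "Sigma_graph M d \<subseteq> CS_graph M d"
  proof
    fix e assume e: "e \<in> Sigma_graph M d"
    then obtain x y where xy: "e = {x, y}" "x \<in> M" "y \<in> M" "x \<noteq> y"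
      using Sigma_graph_subset unfolding complete_edges_def by blast
    moreover have "d x y = r" using const e xy by simp
    ultimately show "e \<in> CS_graph M d"
      using Sigma_edge_shortest[OF const]
      by (metis DiffD1 DiffD2 insertI1 nearest_neighbour_in_CS_graph)
  qed
qed (rule CS_graph_subset_Sigma_graph)

lemma CS_graph_eq_MC_graph:
  assumes const: "\<And>x y. {x, y} \<in> Sigma_graph M d \<Longrightarrow> d x y = r"
  shows "CS_graph M d = MC_graph M d"
proof
  show "MC_graph M d \<subseteq> CS_graph M d"
  proof
    fix e assume e: "e \<in> MC_graph M d"
    then obtain x y where xy: "e = {x, y}" "x \<in> M" "y \<in> M" "x \<noteq> y"
      unfolding MC_graph_eq threshold_graph_def by blast
    \<comment> \<open>To bound the threshold by \<open>r\<close>, the value \<open>r\<close> must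
      occur as a distance; an edge of the connected graph \<open>Sigma_graph M d\<close> leaving
      \<open>x\<close> realises it.\<close>
    have "{x} \<subseteq> M" "x \<in> {x}" "y \<in> M - {x}" using xy by auto
    with connected_Sigma_graph
    obtain u v where uv: "u \<in> {x}" "v \<in> M - {x}" "{u, v} \<in> Sigma_graph M d"
      by (rule connected_graph_crossing)
    then have r: "d u v = r" "u \<in> M" "v \<in> M" using const[OF uv(3)] xy(2) by auto
    have "Sigma_graph M d \<subseteq> threshold_graph M d r"
    proof
      fix f assume f: "f \<in> Sigma_graph M d"
      then obtain a b where ab: "f = {a, b}" "a \<in> M" "b \<in> M" "a \<noteq> b"
        using Sigma_graph_subset unfolding complete_edges_def by blast
      then have "d a b \<le> r" using const f by simp
      with ab show "f \<in> threshold_graph M d r" unfolding threshold_graph_def by blast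
    qed
    with connected_Sigma_graph have "connected_graph M (threshold_graph M d (d u v))"
      unfolding r(1) by (rule connected_graph_mono)
    with r(2,3) have "MC_graph M d \<subseteq> threshold_graph M d (d u v)"
      by (rule MC_graph_subset_threshold_graph)
    then have "e \<in> threshold_graph M d r" using e r(1) by auto
    then have "d x y \<le> r"
      using xy by (auto simp: threshold_graph_def doubleton_eq_iff commute)
    then show "e \<in> CS_graph M d"
      using Sigma_edge_shortest[OF const] xy
      by (metis DiffD1 DiffD2 insertI1 nearest_neighbour_in_CS_graph order.trans)
  qed
qed (rule CS_graph_subset_MC_graph)

end

subsection \<open>A space separating the three graphs\<close>

text \<open>The only equality in a triangle of distinct points is 3 + 5 = 8, so
  \<open>{1, 3}\<close> alone lies in \<open>Q_edges\<close>. Unordered pairs make symmetry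
  immediate, and the default 0 covers the diagonal.\<close>

definition separating_dist :: "nat \<Rightarrow> nat \<Rightarrow> real" where
  "separating_dist x y =
     (if {x, y} = {0, 1} then 2 else
      if {x, y} = {1, 2} then 3 else
      if {x, y} = {0, 2} then 4 else
      if {x, y} = {2, 3} then 5 else
      if {x, y} = {0, 3} then 7 else
      if {x, y} = {1, 3} then 8 else 0)"

declare One_nat_def [simp del]

lemma separating_dist_values [simp]:
  "separating_dist x x = 0"
  "separating_dist 0 1 = 2" "separating_dist 1 0 = 2"
  "separating_dist 1 2 = 3" "separating_dist 2 1 = 3"
  "separating_dist 0 2 = 4" "separating_dist 2 0 = 4"
  "separating_dist 2 3 = 5" "separating_dist 3 2 = 5"
  "separating_dist 0 3 = 7" "separating_dist 3 0 = 7"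
  "separating_dist 1 3 = 8" "separating_dist 3 1 = 8"
  by (auto simp: separating_dist_def doubleton_eq_iff)

interpretation separating: finite_Metric_space "{0, 1, 2, 3}" separating_dist
proof
  show "0 \<le> separating_dist x y" for x y
    by (simp add: separating_dist_def)
  show "separating_dist x y = separating_dist y x" for x y
    by (simp add: separating_dist_def insert_commute)
qed auto

lemma separating_Sigma_edges:
  "{0, 1} \<in> Sigma_graph {0, 1, 2, 3} separating_dist"
  "{0, 3} \<in> Sigma_graph {0, 1, 2, 3} separating_dist"
  "{1, 3} \<notin> Sigma_graph {0, 1, 2, 3} separating_dist"
  \<comment> \<open>The witness 2 lies between 1 and 3.\<close>
  by (auto simp: separating.Sigma_graph_iff intro!: bexI[of _ 2])

text \<open>The pair \<open>{1, 3}\<close> is missing from \<open>Sigma_graph\<close>, whose edges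
  \<open>{0, 1}\<close> and \<open>{0, 3}\<close> have different lengths 2 and 7.\<close>

lemma separating_intrinsic_II: "intrinsic_II {0, 1, 2, 3} separating_dist"
proof -
  have "{1, 3} \<in> complete_edges {0, 1, 2, 3 :: nat}"
    unfolding complete_edges_def by force
  then have "intrinsic {0, 1, 2, 3} separating_dist"
    using separating_Sigma_edges(3) by (auto simp: intrinsic_def)
  moreover have "\<not> intrinsic_I {0, 1, 2, 3} separating_dist"
  proof
    assume "intrinsic_I {0, 1, 2, 3} separating_dist"
    then have "separating_dist 0 1 = separating_dist 0 3"
      using separating_Sigma_edges(1,2) unfolding intrinsic_I_def by metis
    then show False by simp
  qed
  ultimately show ?thesis by (simp add: intrinsic_II_def)
qed

lemma separating_connected_threshold_graph:
  "connected_graph {0, 1, 2, 3} (threshold_graph {0, 1, 2, 3} separating_dist 5)"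
\<comment> \<open>The point 2 is the centre of a star: its distances to 0, 1 and 3 are 4, 3 and
  5.\<close>
proof (rule connected_graphI[where c = 2])
  let ?A = "adjacent {0, 1, 2, 3} (threshold_graph {0, 1, 2, 3} separating_dist 5)"
  have *: "?A x y" if "x \<in> {0, 1, 2, 3}" "y \<in> {0, 1, 2, 3}" "x \<noteq> y" "separating_dist x y \<le> 5"
    for x y
    using that unfolding adjacent_def threshold_graph_def by blast
  show "?A\<^sup>*\<^sup>* x 2" if "x \<in> {0, 1, 2, 3}" for x
    using that *[of x 2] by (cases "x = 2") auto
qed

lemma separating_not_in_MC_graph: "{0, 3} \<notin> MC_graph {0, 1, 2, 3} separating_dist"
proof -
  have "MC_graph {0, 1, 2, 3} separating_dist \<subseteq> threshold_graph {0, 1, 2, 3} separating_dist 5"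
    using separating.MC_graph_subset_threshold_graph[of 2 3] separating_connected_threshold_graph
    by simp
  moreover have "{0, 3} \<notin> threshold_graph {0, 1, 2, 3} separating_dist 5"
    by (auto simp: threshold_graph_def doubleton_eq_iff)
  ultimately show ?thesis by blast
qed

lemma separating_in_MC_graph: "{0, 2} \<in> MC_graph {0, 1, 2, 3} separating_dist"
proof -
  have "connected_graph {0, 1, 2, 3} (MC_graph {0, 1, 2, 3} separating_dist)"
    by (rule separating.connected_MC_graph) simp
  \<comment> \<open>The cut isolates 3, whose distances to the other points are at least 5, hence
    larger than the distance 4 from 0 to 2.\<close>
  moreover have "{3} \<subseteq> {0, 1, 2, 3 :: nat}" "3 \<in> {3 :: nat}" "0 \<in> {0, 1, 2, 3} - {3 :: nat}"
    by auto
  ultimately obtain u v where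
    uv: "u \<in> {3}" "v \<in> {0, 1, 2, 3} - {3}" "{u, v} \<in> MC_graph {0, 1, 2, 3} separating_dist"
    by (rule connected_graph_crossing)
  then have "separating_dist 0 2 \<le> separating_dist u v" by auto
  with uv(3) show ?thesis by (rule separating.MC_graph_downward_closed) simp_all
qed

lemma separating_not_in_CS_graph: "{0, 2} \<notin> CS_graph {0, 1, 2, 3} separating_dist"
  \<comment> \<open>The point 1 violates the inequality, since 4 exceeds both 2 and 3.\<close>
  using separating.CS_graph_ultrametric[of 0 2 1] by auto

theorem theorem7p1:
  "(\<forall>(M :: 'a set) d. Metric_space M d \<and> finite M \<and> 2 \<le> card M \<longrightarrow>
      (CS_graph M d \<subseteq> Sigma_graph M d \<and> CS_graph M d \<subseteq> MC_graph M d) \<and>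
      (intrinsic_I M d \<longrightarrow>
         Sigma_graph M d = CS_graph M d \<and> CS_graph M d = MC_graph M d) \<and>
      (intrinsic_II M d \<and> is_tree M (Sigma_graph M d) \<longrightarrow>
         Sigma_graph M d = CS_graph M d)) \<and>
   (\<exists>(N :: nat set) e. Metric_space N e \<and> finite N \<and> 2 \<le> card N \<and> intrinsic_II N e \<and>
      Sigma_graph N e \<noteq> CS_graph N e \<and>
      Sigma_graph N e \<noteq> MC_graph N e \<and>
      CS_graph N e \<noteq> MC_graph N e)"
proof (intro conjI allI impI)
  fix M :: "'a set" and d
  assume M: "Metric_space M d \<and> finite M \<and> 2 \<le> card M"
  then interpret finite_Metric_space M d
    by (simp add: finite_Metric_space_def finite_Metric_space_axioms_def)
  show "CS_graph M d \<subseteq> Sigma_graph M d" by (rule CS_graph_subset_Sigma_graph)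
  show "CS_graph M d \<subseteq> MC_graph M d" by (rule CS_graph_subset_MC_graph)
  show "Sigma_graph M d = CS_graph M d" "CS_graph M d = MC_graph M d" if "intrinsic_I M d"
    using that CS_graph_eq_Sigma_graph CS_graph_eq_MC_graph unfolding intrinsic_I_def by metis+
  show "Sigma_graph M d = CS_graph M d" if "intrinsic_II M d \<and> is_tree M (Sigma_graph M d)"
    using that tree_eq_connected_subgraph connected_CS_graph CS_graph_subset_Sigma_graph
      Sigma_graph_subset by metis
next
  show "\<exists>(N :: nat set) e. Metric_space N e \<and> finite N \<and> 2 \<le> card N \<and> intrinsic_II N e \<and>
      Sigma_graph N e \<noteq> CS_graph N e \<and>
      Sigma_graph N e \<noteq> MC_graph N e \<and>
      CS_graph N e \<noteq> MC_graph N e"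
    \<comment> \<open>The edge \<open>{0, 3}\<close> of \<open>Sigma_graph\<close> is not in
      \<open>MC_graph\<close>, hence not in its subgraph \<open>CS_graph\<close>;
      \<open>{0, 2}\<close> separates the latter two.\<close>
    using separating.Metric_space_axioms separating_intrinsic_II separating_Sigma_edges(2)
      separating_not_in_MC_graph separating_in_MC_graph separating_not_in_CS_graph
      separating.CS_graph_subset_MC_graph
    by (intro exI[of _ "{0, 1, 2, 3}"] exI[of _ separating_dist]) auto
qed

end
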